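(* Let $t\ge 4$ be an integer. If $G$ is a $K_{1,t}$-free graph and $r(G)\le r$, then $$\chi(G)\ \le\ (t-1)\Big(r+\binom{t-1}{2}-3\Big).$$ Moreover, if $G$ is a $K_{1,3}$-free graph, then $\chi(G)\le 2\,r(G)$.
   Context: All graphs are finite, simple, undirected and loopless. $\chi(G)$ is the chromatic number of $G$. A graph is $H$-free if it has no induced subgraph isomorphic to $H$. $K_{1,t}$ is the star with $t$ leaves. A path in $G$ is a (not necessarily induced) subgraph of $G$ that is a path. For a graph $G$, $r(G)$ denotes the maximum of $\chi(G[V(P)])$ over all paths $P$ in $G$, where $G[V(P)]$ is the subgraph of $G$ induced by the vertex set of $P$. *)

theory Defs
  imports "Graph_Theory.Graph_Theory"
begin

text \<open>
  Finite simple undirected graphs are the library's \<^locale>\<open>graph\<close>s: finite symmetric digraphs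
  without loops or parallel arcs, an undirected edge being a pair of opposite arcs. Paths
  are the library's \<^const>\<open>vpath\<close>s, i.e. nonempty lists of distinct vertices, consecutive ones
  being adjacent; single vertices count as paths.
\<close>

definition proper_colouring :: "('a, 'b) pre_digraph \<Rightarrow> nat \<Rightarrow> ('a \<Rightarrow> nat) \<Rightarrow> bool" where
  "proper_colouring G k c \<longleftrightarrow>
     c ` verts G \<subseteq> {..<k} \<and> (\<forall>u v. u \<rightarrow>\<^bsub>G\<^esub> v \<longrightarrow> c u \<noteq> c v)"

definition chromatic_number :: "('a, 'b) pre_digraph \<Rightarrow> nat" where
  "chromatic_number G = (LEAST k. \<exists>c. proper_colouring G k c)"

definition induced_free :: "('c, 'd) pre_digraph \<Rightarrow> ('a, 'b) pre_digraph \<Rightarrow> bool" where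
  "induced_free H G \<longleftrightarrow> \<not> (\<exists>S. induced_subgraph S G \<and> digraph_iso S H)"

definition star :: "nat \<Rightarrow> (nat, nat \<times> nat) pre_digraph" where
  "star t = \<lparr> verts = {0..t}, arcs = {0} \<times> {1..t} \<union> {1..t} \<times> {0}, tail = fst, head = snd \<rparr>"

text \<open>
  The paths of a finite graph are finitely many, so the supremum is a maximum; on the null
  graph, which has no path, it is 0.
\<close>
definition path_chromatic_number :: "('a, 'b) pre_digraph \<Rightarrow> nat" where
  "path_chromatic_number G = (SUP p \<in> {p. vpath p G}. chromatic_number (G \<restriction> set p))"

lemma complete_bipartite_star: "K\<^bsub>1,t\<^esub> (star t)"
proof -
  have ends: "arcs_ends (star t) = {0} \<times> {1..t} \<union> {1..t} \<times> {0}"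
    by (auto simp: arcs_ends_conv star_def)
  have "graph (star t)"
    by unfold_locales
      (auto simp: star_def arc_to_ends_def symmetric_def arcs_ends_def intro!: symI)
  moreover have "verts (star t) = {0} \<union> {1..t}"
    by (auto simp: star_def)
  ultimately show ?thesis
    unfolding complete_bipartite_digraph_def ends
    by (intro conjI exI[of _ "{0}"] exI[of _ "{1..t}"]) auto
qed

lemma proper_colouring_exists:
  assumes "graph G"
  shows "\<exists>k c. proper_colouring G k c"
proof -
  interpret graph G by fact
  obtain c :: "'a \<Rightarrow> nat" and n where c: "c ` verts G = {i. i < n}" "inj_on c (verts G)"
    using finite_imp_inj_to_nat_seg[OF finite_verts] by blast
  have "c u \<noteq> c v" if "u \<rightarrow>\<^bsub>G\<^esub> v" for u v
    using that c(2) adj_in_verts[OF that] adj_not_same by (metis inj_onD)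
  with c(1) have "proper_colouring G n c"
    by (auto simp: proper_colouring_def)
  then show ?thesis by blast
qed

lemma finite_vpaths:
  assumes "graph G"
  shows "finite {p. vpath p G}"
proof -
  interpret graph G by fact
  have "{p. vpath p G} \<subseteq> {p. set p \<subseteq> verts G \<and> distinct p}"
    by (auto simp: vpath_def vwalk_def)
  then show ?thesis
    using finite_subset_distinct[OF finite_verts] finite_subset by blast
qed

lemma path_chromatic_number_eq_Max:
  assumes "graph G" and "verts G \<noteq> {}"
  shows "path_chromatic_number G = Max ((\<lambda>p. chromatic_number (G \<restriction> set p)) ` {p. vpath p G})"
proof -
  obtain v where "v \<in> verts G" using assms(2) by blast
  then have "vpath [v] G" by (auto simp: vpath_def vwalk_def)
  then show ?thesis
    unfolding path_chromatic_number_def Sup_nat_def by auto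
qed

end

theory Submission
  imports Defs "HOL-Combinatorics.Transposition"
begin

text \<open>
  Suppose that, for every vertex \<open>v\<close>, the neighbourhood \<open>N(v)\<close> is \<open>K\<close>-colourable. In a
  \<open>K\<^bsub>1,t\<^esub>\<close>-free graph every colour class in \<open>N(v)\<close> has at most \<open>t - 1\<close> vertices, so all degrees are
  at most \<open>(t - 1) K\<close> (\<open>card_le_of_colourable\<close>), and greedy colouring needs no more than
  \<open>(t - 1) K + 1 \<le> (t - 1) (K + 1)\<close> colours (\<open>greedy_colouring\<close>). The theorem is thus reduced to
  colouring neighbourhoods, and there the parameter \<open>r\<close> comes in: a path inside \<open>N(v)\<close> can be
  prolonged by \<open>v\<close>, whose colour is then missing on the path, so the vertices of every path inside
  \<open>N(v)\<close> are \<open>(r - 1)\<close>-colourable (\<open>colourable_remove_apex\<close>).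

  What remains is a statement on a set \<open>A\<close> of vertices, all of whose paths are \<open>k\<close>-colourable and
  all of whose independent subsets have at most \<open>s\<close> elements. An argument of Chvatal and Erdos
  (\<open>spanning_path_or_small_separator\<close>) shows that a longest path in \<open>A\<close> exhausts \<open>A\<close>, unless
  \<open>A\<close> is separated by at most \<open>s - 2\<close> vertices. For \<open>s \<le> 3\<close> the separator has at most one
  vertex, colourings of the two sides can be glued, and by induction on the size \<open>A\<close> is
  \<open>k\<close>-colourable (\<open>colourable_independence_3\<close>). For \<open>s > 3\<close> the separator gets new colours;
  each of the two sides has smaller independence number, since an independent set of one side
  can be enlarged by a vertex of the other. By induction on \<open>s\<close> this costs
  \<open>2 + 3 + \<dots> + (s - 2) = (s - 1 choose 2) - 1\<close> additional colours
  (\<open>colourable_independence\<close>).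

  With \<open>s = t - 1\<close> and \<open>k = r - 1\<close> one may take \<open>K + 1 = r\<close> for \<open>t = 3\<close>, and
  \<open>K + 1 = r + (t - 2 choose 2) - 1 \<le> r + (t - 1 choose 2) - 3\<close> for \<open>t \<ge> 4\<close>.
\<close>

section \<open>Colourings of vertex sets\<close>

definition colourable :: "('a \<Rightarrow> 'a \<Rightarrow> bool) \<Rightarrow> nat \<Rightarrow> 'a set \<Rightarrow> bool" where
  "colourable E k A \<longleftrightarrow> (\<exists>c. c ` A \<subseteq> {..<k} \<and> (\<forall>u\<in>A. \<forall>v\<in>A. E u v \<longrightarrow> c u \<noteq> c v))"

definition independent :: "('a \<Rightarrow> 'a \<Rightarrow> bool) \<Rightarrow> 'a set \<Rightarrow> bool" where
  "independent E Y \<longleftrightarrow> pairwise (\<lambda>u v. \<not> E u v) Y"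

definition independence_at_most :: "('a \<Rightarrow> 'a \<Rightarrow> bool) \<Rightarrow> nat \<Rightarrow> 'a set \<Rightarrow> bool" where
  "independence_at_most E s A \<longleftrightarrow> (\<forall>Y\<subseteq>A. independent E Y \<longrightarrow> card Y \<le> s)"

definition simple_path :: "('a \<Rightarrow> 'a \<Rightarrow> bool) \<Rightarrow> 'a list \<Rightarrow> bool" where
  "simple_path E p \<longleftrightarrow> distinct p \<and> successively E p"

definition paths_colourable :: "('a \<Rightarrow> 'a \<Rightarrow> bool) \<Rightarrow> nat \<Rightarrow> 'a set \<Rightarrow> bool" where
  "paths_colourable E k A \<longleftrightarrow> (\<forall>p. simple_path E p \<longrightarrow> set p \<subseteq> A \<longrightarrow> colourable E k (set p))"

lemma colourable_mono:
  assumes "colourable E k A" "B \<subseteq> A" "k \<le> l"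
  shows "colourable E l B"
proof -
  obtain c where c: "c ` A \<subseteq> {..<k}" "\<forall>u\<in>A. \<forall>v\<in>A. E u v \<longrightarrow> c u \<noteq> c v"
    using assms(1) by (auto simp: colourable_def)
  have "c ` B \<subseteq> {..<l}" using c(1) assms(2,3) by fastforce
  moreover have "\<forall>u\<in>B. \<forall>v\<in>B. E u v \<longrightarrow> c u \<noteq> c v" using c(2) assms(2) by blast
  ultimately show ?thesis unfolding colourable_def by blast
qed

lemma colourable_empty [simp]: "colourable E k {}"
  by (simp add: colourable_def)

lemma paths_colourable_mono:
  "paths_colourable E k A \<Longrightarrow> B \<subseteq> A \<Longrightarrow> paths_colourable E k B"
  by (auto simp: paths_colourable_def)

lemma independence_at_most_mono:
  "independence_at_most E s A \<Longrightarrow> B \<subseteq> A \<Longrightarrow> s \<le> s' \<Longrightarrow> independence_at_most E s' B"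
  unfolding independence_at_most_def by (meson order_trans)

text \<open>Every colour class is independent.\<close>
lemma card_le_of_colourable:
  assumes "finite A" "colourable E k A" "independence_at_most E s A"
  shows "card A \<le> s * k"
proof -
  obtain c where c: "c ` A \<subseteq> {..<k}" "\<forall>u\<in>A. \<forall>v\<in>A. E u v \<longrightarrow> c u \<noteq> c v"
    using assms(2) by (auto simp: colourable_def)
  have "A = (\<Union>i<k. {u\<in>A. c u = i})" using c(1) by auto
  then have "card A \<le> (\<Sum>i<k. card {u\<in>A. c u = i})"
    by (metis card_UN_le finite_lessThan)
  also have "\<dots> \<le> (\<Sum>i<k. s)"
  proof (rule sum_mono)
    fix i
    have "independent E {u\<in>A. c u = i}"
      using c(2) unfolding independent_def pairwise_def by fastforce
    then show "card {u\<in>A. c u = i} \<le> s"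
      using assms(3) by (auto simp: independence_at_most_def)
  qed
  finally show ?thesis by (simp add: mult.commute)
qed

locale adjacency =
  fixes E :: "'a \<Rightarrow> 'a \<Rightarrow> bool"
  assumes sym: "E u v \<Longrightarrow> E v u"
    and irrefl: "\<not> E v v"
begin

lemma greedy_colouring:
  assumes "finite V" "\<And>v. v \<in> V \<Longrightarrow> card {u\<in>V. E v u} \<le> d"
  shows "colourable E (Suc d) V"
  using assms
proof (induction V rule: finite_induct)
  case (insert x V)
  have "card {u\<in>V. E v u} \<le> d" if "v \<in> V" for v
  proof -
    have "card {u\<in>V. E v u} \<le> card {u \<in> insert x V. E v u}"
      using insert.hyps(1) by (intro card_mono) auto
    then show ?thesis using insert.prems[of v] that by simp
  qed
  then obtain c where c: "c ` V \<subseteq> {..<Suc d}" "\<forall>u\<in>V. \<forall>v\<in>V. E u v \<longrightarrow> c u \<noteq> c v"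
    using insert.IH by (auto simp: colourable_def)
  let ?N = "{u \<in> insert x V. E x u}"
  have "card (c ` ?N) < card {..<Suc d}"
    using insert.prems[of x] card_image_le[of ?N c] insert.hyps(1) by simp
  moreover have "finite (c ` ?N)" using insert.hyps(1) by simp
  ultimately have "\<not> {..<Suc d} \<subseteq> c ` ?N" using card_mono leD by blast
  then obtain i where i: "i < Suc d" "i \<notin> c ` ?N" by auto
  let ?c = "c(x := i)"
  have "?c ` insert x V \<subseteq> {..<Suc d}" using c(1) i(1) by auto
  moreover have "?c u \<noteq> ?c v" if uv: "u \<in> insert x V" "v \<in> insert x V" "E u v" for u v
  proof -
    consider "u = x" "v \<noteq> x" | "v = x" "u \<noteq> x" | "u \<noteq> x" "v \<noteq> x"
      using uv(3) irrefl by metis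
    then show ?thesis
    proof cases
      case 1
      then have "v \<in> ?N" using uv by auto
      then show ?thesis using 1 i(2) by auto
    next
      case 2
      then have "u \<in> ?N" using uv sym by auto
      then show ?thesis using 2 i(2) by auto
    next
      case 3
      then show ?thesis using uv c(2) by auto
    qed
  qed
  ultimately show ?case unfolding colourable_def by blast
qed simp

lemma colourable_remove_apex:
  assumes "colourable E k (insert v A)" "\<And>u. u \<in> A \<Longrightarrow> E v u"
  shows "colourable E (k - 1) A"
proof -
  obtain c where c: "c ` insert v A \<subseteq> {..<k}"
    "\<forall>u\<in>insert v A. \<forall>w\<in>insert v A. E u w \<longrightarrow> c u \<noteq> c w"
    using assms(1) by (auto simp: colourable_def)
  \<comment> \<open>Exchange colours so that the apex has the last one.\<close>
  let ?t = "transpose (c v) (k - 1)"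
  have "(?t \<circ> c) u < k - 1" if "u \<in> A" for u
  proof -
    have "c u \<noteq> c v" "c u < k" using c assms(2)[OF that] that by auto
    moreover have "c v < k" using c by auto
    ultimately show ?thesis by (auto simp: transpose_def)
  qed
  moreover have "(?t \<circ> c) u \<noteq> (?t \<circ> c) w" if "u \<in> A" "w \<in> A" "E u w" for u w
    using c(2) that by (simp add: inj_eq[OF inj_on_transpose])
  ultimately show ?thesis
    unfolding colourable_def by (intro exI[of _ "?t \<circ> c"]) auto
qed

text \<open>
  A permutation of the colours makes two colourings agree on a single vertex.
\<close>
lemma colourable_glue:
  assumes "colourable E k (X \<union> D)" "colourable E k (X \<union> R)"
    and "finite X" "card X \<le> 1" "\<And>u w. u \<in> D \<Longrightarrow> w \<in> R \<Longrightarrow> \<not> E u w"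
  shows "colourable E k (X \<union> D \<union> R)"
proof -
  obtain c where c: "c ` (X \<union> D) \<subseteq> {..<k}" "\<forall>u\<in>X \<union> D. \<forall>w\<in>X \<union> D. E u w \<longrightarrow> c u \<noteq> c w"
    using assms(1) by (auto simp: colourable_def)
  obtain c' where c': "c' ` (X \<union> R) \<subseteq> {..<k}" "\<forall>u\<in>X \<union> R. \<forall>w\<in>X \<union> R. E u w \<longrightarrow> c' u \<noteq> c' w"
    using assms(2) by (auto simp: colourable_def)
  obtain e where e: "e ` (X \<union> R) \<subseteq> {..<k}" "\<forall>u\<in>X \<union> R. \<forall>w\<in>X \<union> R. E u w \<longrightarrow> e u \<noteq> e w"
    and agree: "\<forall>x\<in>X. e x = c x"
  proof (cases "X = {}")
    case True
    then show ?thesis using that c' by auto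
  next
    case False
    then have "card X = 1" using assms(3,4) by (simp add: le_antisym Suc_leI card_gt_0_iff)
    then obtain x where x: "X = {x}" using card_1_singletonE by blast
    let ?t = "transpose (c' x) (c x)"
    have "c' x < k" "c x < k" using c(1) c'(1) x by auto
    then have "(?t \<circ> c') ` (X \<union> R) \<subseteq> {..<k}"
      using c'(1) by (fastforce simp: transpose_def)
    moreover have "\<forall>u\<in>X \<union> R. \<forall>w\<in>X \<union> R. E u w \<longrightarrow> (?t \<circ> c') u \<noteq> (?t \<circ> c') w"
      using c'(2) by (simp add: inj_eq[OF inj_on_transpose])
    moreover have "\<forall>y\<in>X. (?t \<circ> c') y = c y" using x by simp
    ultimately show ?thesis using that by blast
  qed
  let ?f = "\<lambda>u. if u \<in> X \<union> D then c u else e u"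
  have "?f ` (X \<union> D \<union> R) \<subseteq> {..<k}" using c(1) e(1) by auto
  moreover have "?f u \<noteq> ?f w"
    if uw: "u \<in> X \<union> D \<union> R" "w \<in> X \<union> D \<union> R" "E u w" for u w
  proof -
    have "{u, w} \<subseteq> X \<union> D \<or> {u, w} \<subseteq> X \<union> R"
      using uw assms(5) sym by blast
    then show ?thesis
    proof
      assume "{u, w} \<subseteq> X \<union> D"
      then show ?thesis using c(2) uw(3) by auto
    next
      assume *: "{u, w} \<subseteq> X \<union> R"
      show ?thesis
      proof (cases "u \<in> D - X \<or> w \<in> D - X")
        case True
        \<comment> \<open>\<open>D\<close> and \<open>R\<close> may share vertices, but these have no neighbours in \<open>R\<close>.\<close>
        then have "{u, w} \<subseteq> X \<union> D" using * uw(3) assms(5) sym by blast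
        then show ?thesis using c(2) uw(3) by auto
      next
        case False
        then have "?f u = e u" "?f w = e w" using agree by auto
        then show ?thesis using e(2) uw(3) * by auto
      qed
    qed
  qed
  ultimately show ?thesis unfolding colourable_def by blast
qed

lemma colourable_add_vertices:
  assumes "colourable E k B" "finite X"
  shows "colourable E (k + card X) (X \<union> B)"
proof -
  obtain c where c: "c ` B \<subseteq> {..<k}" "\<forall>u\<in>B. \<forall>w\<in>B. E u w \<longrightarrow> c u \<noteq> c w"
    using assms(1) by (auto simp: colourable_def)
  obtain h where h: "bij_betw h X {0..<card X}"
    using ex_bij_betw_finite_nat[OF assms(2)] by blast
  let ?f = "\<lambda>u. if u \<in> X then k + h u else c u"
  have "?f ` (X \<union> B) \<subseteq> {..<k + card X}"
    using c(1) bij_betwE[OF h] by fastforce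
  moreover have "?f u \<noteq> ?f w" if "u \<in> X \<union> B" "w \<in> X \<union> B" "E u w" for u w
  proof -
    have "c y < k" if "y \<in> B" for y using c(1) that by auto
    then have *: "k + l \<noteq> c y" "c y \<noteq> k + l" if "y \<in> B" for l y
      using that by (metis not_add_less1)+
    have "u \<noteq> w" using that irrefl by auto
    then have "h u \<noteq> h w" if "u \<in> X" "w \<in> X"
      using that bij_betw_imp_inj_on[OF h] by (meson inj_onD)
    then show ?thesis
      using that c(2) * by auto
  qed
  ultimately show ?thesis unfolding colourable_def by blast
qed

section \<open>Spanning paths and small separators\<close>

lemma simple_path_of_reachable:
  assumes "(\<lambda>u w. E u w \<and> u \<in> W \<and> w \<in> W)\<^sup>*\<^sup>* a b" "b \<in> W"
  shows "\<exists>q. simple_path E q \<and> q \<noteq> [] \<and> hd q = a \<and> last q = b \<and> set q \<subseteq> W"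
  using assms
proof (induction rule: converse_rtranclp_induct)
  case base
  then show ?case by (intro exI[of _ "[b]"]) (auto simp: simple_path_def)
next
  case (step a a')
  then obtain q where q: "simple_path E q" "q \<noteq> []" "hd q = a'" "last q = b" "set q \<subseteq> W"
    by blast
  show ?case
  proof (cases "a \<in> set q")
    case True
    then obtain q1 q2 where "q = q1 @ a # q2" by (meson split_list)
    then show ?thesis
      using q by (intro exI[of _ "a # q2"]) (auto simp: simple_path_def successively_append_iff)
  next
    case False
    then show ?thesis
      using q step by (intro exI[of _ "a # q"]) (auto simp: simple_path_def successively_Cons)
  qed
qed

lemma simple_path_insert:
  assumes "simple_path E (B @ C)" "C \<noteq> []" "simple_path E q" "q \<noteq> []" "set q \<inter> set (B @ C) = {}"
    and "B \<noteq> [] \<Longrightarrow> E (last B) (hd q)" "E (last q) (hd C)"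
  shows "simple_path E (B @ q @ C)"
  using assms by (auto simp: simple_path_def successively_append_iff)

lemma simple_path_insert_rev:
  assumes "simple_path E (B @ C @ F)" "C \<noteq> []" "F \<noteq> []" "simple_path E q" "q \<noteq> []"
    and "set q \<inter> set (B @ C @ F) = {}"
    and "B \<noteq> [] \<Longrightarrow> E (last B) (hd q)" "E (last q) (last C)" "E (hd C) (hd F)"
  shows "simple_path E (B @ q @ rev C @ F)"
proof -
  have "successively E (rev C)"
    using assms(1) sym by (auto simp: simple_path_def successively_append_iff
        intro: successively_mono)
  then show ?thesis
    using assms by (auto simp: simple_path_def successively_append_iff hd_rev last_rev)
qed

text \<open>
  Let \<open>p\<close> be a longest path. If it misses some vertices, let \<open>D\<close> be a component of what it leaves
  over, and let \<open>X\<close> be the set of neighbours of \<open>D\<close> on \<open>p\<close>. If two of the successors of \<open>X\<close> on \<open>p\<close> were adjacent, one could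
  detour through \<open>D\<close>, traverse a part of \<open>p\<close> backwards and obtain a longer path. The same holds
  for the first vertex of \<open>p\<close>, so it forms, together with these successors and a
  vertex of \<open>D\<close>, an independent set of \<open>card X + 2\<close> elements. The last vertex of \<open>p\<close> is not in
  \<open>X\<close>, so that every element of \<open>X\<close> has a successor; the first one is not in \<open>X\<close> either, so that
  \<open>X\<close> separates it from \<open>D\<close>.
\<close>
lemma spanning_path_or_small_separator:
  assumes fin: "finite A" and ind: "independence_at_most E s A"
  obtains p where "simple_path E p" "set p = A"
  | X D R where "A = X \<union> D \<union> R" "D \<noteq> {}" "R \<noteq> {}" "X \<inter> D = {}" "X \<inter> R = {}" "D \<inter> R = {}"
      "\<And>u w. u \<in> D \<Longrightarrow> w \<in> R \<Longrightarrow> \<not> E u w" "card X + 2 \<le> s"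
proof -
  define P where "P p \<longleftrightarrow> simple_path E p \<and> set p \<subseteq> A" for p
  have "P []" by (simp add: P_def simple_path_def)
  moreover have "\<forall>q. P q \<longrightarrow> length q < Suc (card A)"
    unfolding P_def simple_path_def using fin by (metis card_mono distinct_card le_imp_less_Suc)
  ultimately have "\<exists>p. P p \<and> (\<forall>q. P q \<longrightarrow> length q \<le> length p)"
    by (rule ex_has_greatest_nat)
  then obtain p where p: "P p" and longest: "\<And>q. P q \<Longrightarrow> length q \<le> length p"
    by blast
  have path: "simple_path E p" and pA: "set p \<subseteq> A" using p by (auto simp: P_def)
  have dist: "distinct p" using path by (simp add: simple_path_def)
  show thesis
  proof (cases "set p = A")
    case True
    then show thesis using that(1) path by blast
  next
    case False
    then obtain x where x: "x \<in> A" "x \<notin> set p" using pA by blast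
    define W where "W = A - set p"
    define S where "S = (\<lambda>u w. E u w \<and> u \<in> W \<and> w \<in> W)"
    define D where "D = {y. S\<^sup>*\<^sup>* x y}"
    define X where "X = {y \<in> set p. \<exists>d\<in>D. E y d}"
    define R where "R = A - X - D"
    have "x \<in> W" using x by (simp add: W_def)
    have "D \<subseteq> W"
    proof
      fix y assume "y \<in> D"
      then have "S\<^sup>*\<^sup>* x y" by (simp add: D_def)
      then show "y \<in> W" using \<open>x \<in> W\<close> by cases (auto simp: S_def)
    qed
    have "x \<in> D" by (simp add: D_def)
    have "symp S" using sym by (auto simp: symp_def S_def)
    have link: "\<exists>q. simple_path E q \<and> q \<noteq> [] \<and> hd q = a \<and> last q = b \<and> set q \<subseteq> W"
      if "a \<in> D" "b \<in> D" for a b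
    proof -
      have "S\<^sup>*\<^sup>* a x" using that(1) \<open>symp S\<close> by (auto simp: D_def dest: sympD[OF symp_rtranclp])
      then have "S\<^sup>*\<^sup>* a b" using that(2) by (auto simp: D_def)
      then show ?thesis
        using simple_path_of_reachable[of W a b] that(2) \<open>D \<subseteq> W\<close> unfolding S_def by blast
    qed
    have "P [x]" using x by (simp add: P_def simple_path_def)
    then have "p \<noteq> []" using longest by fastforce
    have last_X: "last p \<notin> X"
    proof
      assume "last p \<in> X"
      then obtain d where d: "d \<in> D" "E (last p) d" by (auto simp: X_def)
      then have "P (p @ [d])"
        using path pA \<open>D \<subseteq> W\<close> by (auto simp: P_def simple_path_def successively_append_iff W_def)
      then show False using longest by fastforce
    qed
    \<comment> \<open>The positions on \<open>p\<close> before which a detour through \<open>D\<close> can end: the start, and the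
      successors of \<open>X\<close>.\<close>
    define J where "J = {j. j < length p \<and> (j = 0 \<or> p ! (j - 1) \<in> X)}"
    have "0 \<in> J" using \<open>p \<noteq> []\<close> by (simp add: J_def)
    have detour: "\<exists>q. simple_path E q \<and> q \<noteq> [] \<and> set q \<subseteq> W \<and> last q = d
        \<and> (take j p \<noteq> [] \<longrightarrow> E (last (take j p)) (hd q))" if "j \<in> J" "d \<in> D" for j d
    proof (cases j)
      case 0
      then show ?thesis
        using that \<open>D \<subseteq> W\<close> by (intro exI[of _ "[d]"]) (auto simp: simple_path_def)
    next
      case (Suc i)
      then have "p ! i \<in> X" "i < length p" using that by (auto simp: J_def)
      then obtain d' where d': "d' \<in> D" "E (p ! i) d'" by (auto simp: X_def)
      then show ?thesis
        using link[OF d'(1) that(2)] Suc \<open>i < length p\<close> by (auto simp: take_Suc_conv_app_nth)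
    qed
    have D_J: "\<not> E d (p ! j)" if jd: "j \<in> J" "d \<in> D" for j d
    proof
      assume adj: "E d (p ! j)"
      obtain q where q: "simple_path E q" "q \<noteq> []" "set q \<subseteq> W" "last q = d"
        "take j p \<noteq> [] \<Longrightarrow> E (last (take j p)) (hd q)"
        using detour[OF jd] by blast
      have j: "j < length p" using jd(1) by (simp add: J_def)
      have "simple_path E (take j p @ q @ drop j p)"
        using q path j adj by (intro simple_path_insert) (auto simp: W_def hd_drop_conv_nth)
      moreover have "set (take j p @ q @ drop j p) \<subseteq> A"
        using q(3) pA set_take_subset[of j p] set_drop_subset[of j p] by (auto simp: W_def)
      ultimately have "length (take j p @ q @ drop j p) \<le> length p"
        by (intro longest) (simp add: P_def)
      then show False using q(2) j by simp
    qed
    have J_J: "\<not> E (p ! i) (p ! j)" if ij: "i \<in> J" "j \<in> J" "i < j" for i j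
    proof
      assume adj: "E (p ! i) (p ! j)"
      have j: "j < length p" "p ! (j - 1) \<in> X" using ij by (auto simp: J_def)
      then obtain d where d: "d \<in> D" "E (p ! (j - 1)) d" by (auto simp: X_def)
      obtain q where q: "simple_path E q" "q \<noteq> []" "set q \<subseteq> W" "last q = d"
        "take i p \<noteq> [] \<Longrightarrow> E (last (take i p)) (hd q)"
        using detour[OF ij(1) d(1)] by blast
      define C where "C = drop i (take j p)"
      have split: "take i p @ C @ drop j p = p"
        using append_take_drop_id[of i "take j p"] append_take_drop_id[of j p] ij(3)
        unfolding C_def by (metis append.assoc less_imp_le min.absorb1 take_take)
      have len: "length (take i p @ C @ drop j p) = length p" using split by (rule arg_cong)
      have C: "C \<noteq> []" "hd C = p ! i" "last C = p ! (j - 1)"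
        using ij(3) j(1) by (auto simp: C_def hd_drop_conv_nth last_conv_nth)
      have "simple_path E (take i p @ q @ rev C @ drop j p)"
      proof (rule simple_path_insert_rev)
        show "simple_path E (take i p @ C @ drop j p)" unfolding split by (rule path)
        show "set q \<inter> set (take i p @ C @ drop j p) = {}" unfolding split using q(3) by (auto simp: W_def)
        show "E (last q) (last C)" using q(4) C(3) d(2) sym by simp
        show "E (hd C) (hd (drop j p))" using C(2) adj j(1) by (simp add: hd_drop_conv_nth)
      qed (use q C j in auto)
      moreover have "set (take i p @ q @ rev C @ drop j p) = set q \<union> set p"
        using arg_cong[OF split, of set] by auto
      ultimately have "P (take i p @ q @ rev C @ drop j p)"
        using q(3) pA by (auto simp: P_def W_def)
      then have "length (take i p @ q @ rev C @ drop j p) \<le> length p" by (rule longest)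
      moreover have "0 < length q" using q(2) by simp
      ultimately show False using len unfolding length_append length_rev by linarith
    qed
    have J_sub: "J \<subseteq> {..<length p}" by (auto simp: J_def)
    then have "finite J" using finite_subset by blast
    have inj: "inj_on ((!) p) J" using inj_on_nth[OF dist] J_sub by blast
    define Y where "Y = insert x ((!) p ` J)"
    have "independent E Y"
      unfolding independent_def pairwise_def
    proof (intro ballI impI)
      fix a b assume "a \<in> Y" "b \<in> Y" "a \<noteq> b"
      then consider j where "j \<in> J" "{a, b} = {x, p ! j}"
        | i j where "i \<in> J" "j \<in> J" "i < j" "{a, b} = {p ! i, p ! j}"
        unfolding Y_def by (auto simp: insert_commute) (metis insert_commute linorder_neqE_nat)
      then show "\<not> E a b"
      proof cases
        case 1
        then show ?thesis using D_J[OF _ \<open>x \<in> D\<close>] sym by (metis doubleton_eq_iff)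
      next
        case 2
        then show ?thesis using J_J sym by (metis doubleton_eq_iff)
      qed
    qed
    moreover have "(!) p ` J \<subseteq> set p" using J_sub by force
    then have "Y \<subseteq> A" using x(1) pA by (auto simp: Y_def)
    ultimately have "card Y \<le> s" using ind by (simp add: independence_at_most_def)
    moreover have "card Y = Suc (card J)"
    proof -
      have "x \<notin> (!) p ` J" using x(2) J_sub by (auto simp: subset_iff)
      then show ?thesis using \<open>finite J\<close> card_image[OF inj] by (simp add: Y_def)
    qed
    moreover have "card X \<le> card (J - {0})"
    proof (rule surj_card_le)
      show "finite (J - {0})" using \<open>finite J\<close> by simp
      show "X \<subseteq> (\<lambda>j. p ! (j - 1)) ` (J - {0})"
      proof
        fix y assume y: "y \<in> X"
        then obtain i where i: "i < length p" "p ! i = y" by (auto simp: X_def in_set_conv_nth)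
        have "i \<noteq> length p - 1" using last_X y i(2) \<open>p \<noteq> []\<close> by (auto simp: last_conv_nth)
        then have "Suc i \<in> J - {0}" using i y by (auto simp: J_def)
        then show "y \<in> (\<lambda>j. p ! (j - 1)) ` (J - {0})" using i(2) by force
      qed
    qed
    moreover have "0 < card J" using \<open>0 \<in> J\<close> \<open>finite J\<close> by (auto simp: card_gt_0_iff)
    moreover have "card (J - {0}) = card J - 1" using \<open>0 \<in> J\<close> by simp
    ultimately have card: "card X + 2 \<le> s" by linarith
    have "p ! 0 \<notin> X" using D_J[OF \<open>0 \<in> J\<close>] sym by (auto simp: X_def)
    then have "p ! 0 \<in> R"
      using \<open>p \<noteq> []\<close> pA \<open>D \<subseteq> W\<close> nth_mem[of 0 p] by (auto simp: R_def W_def)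
    have no_edge: "\<not> E u w" if "u \<in> D" "w \<in> R" for u w
    proof
      assume "E u w"
      then have "w \<notin> set p" using that sym by (auto simp: R_def X_def)
      then have "S u w" using that \<open>E u w\<close> \<open>D \<subseteq> W\<close> by (auto simp: S_def R_def W_def)
      then have "w \<in> D" using that(1) by (auto simp: D_def)
      then show False using that(2) by (simp add: R_def)
    qed
    have "A = X \<union> D \<union> R" using pA \<open>D \<subseteq> W\<close> by (auto simp: R_def X_def W_def)
    moreover have "X \<inter> D = {}" "X \<inter> R = {}" "D \<inter> R = {}"
      using \<open>D \<subseteq> W\<close> by (auto simp: R_def X_def W_def)
    ultimately show thesis
      using that(2)[of X D R] \<open>x \<in> D\<close> \<open>p ! 0 \<in> R\<close> no_edge card by blast
  qed
qed

section \<open>Colouring sets of bounded independence number\<close>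

text \<open>
  A separator \<open>X\<close> of at most one vertex costs no colour. The induction can therefore keep it on
  both sides and run over the size of the set: \<open>X \<union> D\<close> and \<open>X \<union> R\<close> are smaller, although their
  independence number may still be 3.
\<close>
lemma colourable_independence_3:
  assumes "finite A" "paths_colourable E k A" "independence_at_most E 3 A"
  shows "colourable E k A"
  using assms
proof (induction A rule: finite_psubset_induct)
  case (psubset A)
  show ?case
  proof (rule spanning_path_or_small_separator[OF psubset.hyps psubset.prems(2)])
    fix p assume "simple_path E p" "set p = A"
    then show ?thesis using psubset.prems(1) by (auto simp: paths_colourable_def)
  next
    fix X D R
    assume sep: "A = X \<union> D \<union> R" "D \<noteq> {}" "R \<noteq> {}" "X \<inter> D = {}" "X \<inter> R = {}" "D \<inter> R = {}"
      "\<And>u w. u \<in> D \<Longrightarrow> w \<in> R \<Longrightarrow> \<not> E u w" "card X + 2 \<le> 3"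
    have "X \<union> D \<subset> A" "X \<union> R \<subset> A" using sep(1-6) by blast+
    then have "colourable E k (X \<union> D)" "colourable E k (X \<union> R)"
      using psubset.IH psubset.prems
      by (meson order_refl paths_colourable_mono independence_at_most_mono psubset_imp_subset)+
    moreover have "finite X" using psubset.hyps sep(1) by simp
    ultimately show ?thesis
      unfolding sep(1) using sep(7,8) by (intro colourable_glue) auto
  qed
qed

lemma independence_decreases:
  assumes "finite A" "independence_at_most E (Suc s) A" "D \<subseteq> A" "z \<in> A" "z \<notin> D"
    and "\<And>u. u \<in> D \<Longrightarrow> \<not> E u z"
  shows "independence_at_most E s D"
  unfolding independence_at_most_def
proof (intro allI impI)
  fix Y assume Y: "Y \<subseteq> D" "independent E Y"
  have "independent E (insert z Y)"
    using Y assms(6) sym by (auto simp: independent_def pairwise_insert)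
  then have "card (insert z Y) \<le> Suc s"
    using Y(1) assms(2-4) unfolding independence_at_most_def
    by (metis insert_subset subset_trans)
  moreover have "finite Y" using Y(1) assms(1,3) by (meson finite_subset)
  moreover have "z \<notin> Y" using Y(1) assms(5) by blast
  ultimately show "card Y \<le> s" by simp
qed

lemma choose_2_Suc: "Suc n choose 2 = n + (n choose 2)"
  by (simp add: numeral_2_eq_2)

text \<open>
  Here the two sides are coloured without the separator, which has at most \<open>s - 2\<close> vertices and
  receives colours of its own; these numbers add up to the binomial coefficient. The sum starts
  with \<open>s = 4\<close>.
\<close>
lemma colourable_independence:
  assumes "3 \<le> s" "finite A" "paths_colourable E k A" "independence_at_most E s A"
  shows "colourable E (k + (((s - 1) choose 2) - 1)) A"
  using assms
proof (induction s arbitrary: A rule: nat_induct_at_least)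
  case base
  then show ?case using colourable_independence_3 by (simp add: numeral_2_eq_2)
next
  case (Suc s)
  let ?K = "k + (((s - 1) choose 2) - 1)"
  have "Suc s - 1 choose 2 = (s - 1) + (s - 1 choose 2)"
    using Suc.hyps choose_2_Suc[of "s - 1"] by simp
  moreover have "0 < s - 1 choose 2" using Suc.hyps by (intro zero_less_binomial) simp
  ultimately have K: "k + ((Suc s - 1 choose 2) - 1) = ?K + (s - 1)" by linarith
  show ?case
  proof (rule spanning_path_or_small_separator[OF Suc.prems(1,3)])
    fix p assume "simple_path E p" "set p = A"
    then have "colourable E k A" using Suc.prems(2) by (auto simp: paths_colourable_def)
    then show ?thesis by (rule colourable_mono) auto
  next
    fix X D R
    assume sep: "A = X \<union> D \<union> R" "D \<noteq> {}" "R \<noteq> {}" "X \<inter> D = {}" "X \<inter> R = {}" "D \<inter> R = {}"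
      "\<And>u w. u \<in> D \<Longrightarrow> w \<in> R \<Longrightarrow> \<not> E u w" "card X + 2 \<le> Suc s"
    have sub: "D \<subseteq> A" "R \<subseteq> A" "finite X" "finite D" "finite R" using sep(1) Suc.prems(1) by auto
    obtain d z where dz: "d \<in> D" "z \<in> R" using sep(2,3) by blast
    have "independence_at_most E s D"
      using independence_decreases[OF Suc.prems(1,3), of D z] sub dz sep(6,7) by blast
    moreover have "independence_at_most E s R"
      using independence_decreases[OF Suc.prems(1,3), of R d] sub dz sep(6,7) sym by blast
    ultimately have "colourable E ?K D" "colourable E ?K R"
      using Suc.IH sub paths_colourable_mono[OF Suc.prems(2)] by auto
    then have "colourable E ?K (D \<union> R)"
      using colourable_glue[of ?K "{}" D R] sep(7) by simp
    from colourable_add_vertices[OF this sub(3)]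
    have "colourable E (?K + card X) A" by (simp add: sep(1) Un_assoc)
    then show ?thesis unfolding K by (rule colourable_mono) (use sep(8) in auto)
  qed
qed

section \<open>From neighbourhoods to the whole graph\<close>

lemma paths_colourable_neighbours:
  assumes "paths_colourable E r V" "v \<in> V"
  shows "paths_colourable E (r - 1) {u\<in>V. E v u}"
  unfolding paths_colourable_def
proof (intro allI impI)
  fix p assume p: "simple_path E p" "set p \<subseteq> {u\<in>V. E v u}"
  then have "simple_path E (v # p)"
    using irrefl by (cases p) (auto simp: simple_path_def)
  moreover have "set (v # p) \<subseteq> V" using p(2) assms(2) by auto
  ultimately have "colourable E r (set (v # p))"
    using assms(1) by (auto simp only: paths_colourable_def)
  then show "colourable E (r - 1) (set p)"
    using colourable_remove_apex[of r v "set p"] p(2) by auto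
qed

text \<open>
  The single additional colour that greedy colouring needs is absorbed by the factor \<open>s\<close>.
\<close>
lemma colourable_of_neighbourhoods:
  assumes "finite V" "1 \<le> s"
    and "\<And>v. v \<in> V \<Longrightarrow> independence_at_most E s {u\<in>V. E v u}"
    and "\<And>v. v \<in> V \<Longrightarrow> colourable E K {u\<in>V. E v u}"
  shows "colourable E (s * (K + 1)) V"
proof -
  have "colourable E (Suc (s * K)) V"
    using assms by (intro greedy_colouring card_le_of_colourable) auto
  then show ?thesis by (rule colourable_mono) (use assms(2) in auto)
qed

end

section \<open>Digraphs and their adjacency relation\<close>

lemma adjacency_of_graph:
  assumes "graph G"
  shows "adjacency (\<lambda>u v. u \<rightarrow>\<^bsub>G\<^esub> v)"
proof -
  interpret graph G by fact
  show ?thesis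
  proof
    show "v \<rightarrow>\<^bsub>G\<^esub> u" if "u \<rightarrow>\<^bsub>G\<^esub> v" for u v
      using that sym_arcs unfolding symmetric_def by (rule symD[rotated])
    show "\<not> v \<rightarrow>\<^bsub>G\<^esub> v" for v
      using adj_not_same by blast
  qed
qed

lemma colourable_iff_chromatic_number:
  assumes "graph G" "A \<subseteq> verts G"
  shows "colourable (\<lambda>u v. u \<rightarrow>\<^bsub>G\<^esub> v) k A \<longleftrightarrow> chromatic_number (G \<restriction> A) \<le> k"
proof -
  interpret graph G by fact
  have dom: "u \<rightarrow>\<^bsub>G \<restriction> A\<^esub> v \<longleftrightarrow> u \<rightarrow>\<^bsub>G\<^esub> v \<and> u \<in> A \<and> v \<in> A" for u v
    by (auto simp: arcs_ends_conv)
  have iff: "colourable (\<lambda>u v. u \<rightarrow>\<^bsub>G\<^esub> v) k A \<longleftrightarrow> (\<exists>c. proper_colouring (G \<restriction> A) k c)" for k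
    by (auto simp: colourable_def proper_colouring_def dom)
  show ?thesis
  proof
    assume "colourable (\<lambda>u v. u \<rightarrow>\<^bsub>G\<^esub> v) k A"
    then show "chromatic_number (G \<restriction> A) \<le> k"
      unfolding chromatic_number_def iff by (rule Least_le)
  next
    assume le: "chromatic_number (G \<restriction> A) \<le> k"
    obtain l c where "proper_colouring G l c" using proper_colouring_exists assms(1) by blast
    then have "\<exists>c. proper_colouring (G \<restriction> A) l c"
      using assms(2) by (intro exI[of _ c]) (auto simp: proper_colouring_def dom)
    then have "\<exists>c. proper_colouring (G \<restriction> A) (chromatic_number (G \<restriction> A)) c"
      unfolding chromatic_number_def by (rule LeastI)
    then show "colourable (\<lambda>u v. u \<rightarrow>\<^bsub>G\<^esub> v) k A"
      using le colourable_mono iff by blast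
  qed
qed

lemma vpath_of_simple_path:
  assumes "simple_path (\<lambda>u v. u \<rightarrow>\<^bsub>G\<^esub> v) p" "set p \<subseteq> verts G" "p \<noteq> []"
  shows "vpath p G"
proof -
  have "set (vwalk_arcs p) \<subseteq> arcs_ends G" if "successively (\<lambda>u v. u \<rightarrow>\<^bsub>G\<^esub> v) p"
    using that by (induction p rule: vwalk_arcs.induct) auto
  then show ?thesis using assms by (simp add: vpath_def vwalk_def simple_path_def)
qed

lemma paths_colourable_path_chromatic_number:
  assumes "graph G" "path_chromatic_number G \<le> r"
  shows "paths_colourable (\<lambda>u v. u \<rightarrow>\<^bsub>G\<^esub> v) r (verts G)"
  unfolding paths_colourable_def
proof (intro allI impI)
  fix p assume p: "simple_path (\<lambda>u v. u \<rightarrow>\<^bsub>G\<^esub> v) p" "set p \<subseteq> verts G"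
  show "colourable (\<lambda>u v. u \<rightarrow>\<^bsub>G\<^esub> v) r (set p)"
  proof (cases "p = []")
    case False
    then have "vpath p G" using p vpath_of_simple_path by blast
    then have "chromatic_number (G \<restriction> set p) \<le> path_chromatic_number G"
      unfolding path_chromatic_number_def using finite_vpaths[OF assms(1)]
      by (intro cSUP_upper) auto
    then show ?thesis
      using colourable_iff_chromatic_number[OF assms(1) p(2)] assms(2) by auto
  qed simp
qed

text \<open>
  Numbering \<open>Y\<close> yields the map on vertices; a graph has no parallel arcs, so sending an arc to the
  pair of the images of its ends is injective and gives the map on arcs.
\<close>
lemma induced_star:
  assumes "graph G" "v \<in> verts G" "finite Y" "\<And>u. u \<in> Y \<Longrightarrow> v \<rightarrow>\<^bsub>G\<^esub> u"
    and "independent (\<lambda>u w. u \<rightarrow>\<^bsub>G\<^esub> w) Y"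
  shows "\<not> induced_free (star (card Y)) G"
proof -
  interpret graph G by fact
  have sub: "insert v Y \<subseteq> verts G" using assms(2,4) adj_in_verts by blast
  have "v \<notin> Y" using assms(4) adj_not_same by blast
  let ?H = "G \<restriction> insert v Y"
  have H: "induced_subgraph ?H G" using sub by (rule induced_induce)
  obtain g where g: "bij_betw g Y {0..<card Y}"
    using ex_bij_betw_finite_nat[OF assms(3)] by blast
  define h where "h u = (if u = v then 0 else Suc (g u))" for u
  have hv: "h v = 0" by (simp add: h_def)
  have hY: "h ` Y = {1..card Y}"
  proof -
    have "h ` Y = Suc ` (g ` Y)" using \<open>v \<notin> Y\<close> by (force simp: h_def image_image)
    also have "\<dots> = Suc ` {0..<card Y}" using g by (simp add: bij_betw_def)
    also have "\<dots> = {1..card Y}" by (auto simp: image_Suc_atLeastLessThan)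
    finally show ?thesis .
  qed
  have inj: "inj_on h (insert v Y)"
    using bij_betw_imp_inj_on[OF g] by (auto simp: inj_on_def h_def)
  define iso where "iso = \<lparr> iso_verts = h, iso_arcs = (\<lambda>e. (h (tail G e), h (head G e))),
    iso_head = snd, iso_tail = fst \<rparr>"
  have ends: "tail G e = v \<and> head G e \<in> Y \<or> tail G e \<in> Y \<and> head G e = v"
    if "e \<in> arcs ?H" for e
  proof -
    have e: "e \<in> arcs G" "tail G e \<in> insert v Y" "head G e \<in> insert v Y" using that by auto
    then have "tail G e \<rightarrow>\<^bsub>G\<^esub> head G e" by (auto simp: arcs_ends_conv)
    then show ?thesis
      using e no_loops[OF e(1)] assms(5) by (auto simp: independent_def pairwise_def)
  qed
  have "pre_digraph.digraph_isomorphism ?H iso"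
  proof -
    have "inj_on (\<lambda>e. (h (tail G e), h (head G e))) (arcs ?H)"
    proof (rule inj_onI)
      fix e f
      assume e: "e \<in> arcs ?H" and f: "f \<in> arcs ?H"
        and eq: "(h (tail G e), h (head G e)) = (h (tail G f), h (head G f))"
      have "{tail G e, head G e, tail G f, head G f} \<subseteq> insert v Y" using e f by auto
      then have "tail G e = tail G f" "head G e = head G f"
        using eq inj_on_eq_iff[OF inj] by auto
      then show "e = f" using e f no_multi_arcs by (auto simp: arc_to_ends_def)
    qed
    then show ?thesis
      using inj wellformed_induce_subgraph[of "insert v Y"]
      by (simp add: pre_digraph.digraph_isomorphism_def iso_def)
  qed
  moreover have "star (card Y) = app_iso iso ?H"
  proof -
    have "h ` insert v Y = {0..card Y}" using hv hY by (auto simp: image_iff)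
    moreover have "(\<lambda>e. (h (tail G e), h (head G e))) ` arcs ?H
        = {0} \<times> {1..card Y} \<union> {1..card Y} \<times> {0}" (is "?L = ?R")
    proof
      show "?L \<subseteq> ?R"
      proof
        fix a assume "a \<in> ?L"
        then obtain e where e: "e \<in> arcs ?H" "a = (h (tail G e), h (head G e))" by blast
        from ends[OF e(1)] show "a \<in> ?R" using e(2) hv hY by auto
      qed
      show "?R \<subseteq> ?L"
      proof
        fix a assume "a \<in> ?R"
        then obtain y where y: "y \<in> Y" "a = (h v, h y) \<or> a = (h y, h v)"
          unfolding hY[symmetric] hv by auto
        have vy: "v \<rightarrow>\<^bsub>G\<^esub> y" "y \<rightarrow>\<^bsub>G\<^esub> v"
          using assms(4)[OF y(1)] adjacency.sym[OF adjacency_of_graph[OF assms(1)]] by blast+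
        then obtain e f where "e \<in> arcs G" "tail G e = v" "head G e = y"
          "f \<in> arcs G" "tail G f = y" "head G f = v"
          by (auto simp: arcs_ends_conv)
        then show "a \<in> ?L" using y by force
      qed
    qed
    ultimately show ?thesis by (simp add: star_def app_iso_def iso_def)
  qed
  ultimately have "digraph_iso ?H (star (card Y))" unfolding digraph_iso_def by blast
  then show ?thesis using H by (auto simp: induced_free_def)
qed

lemma independence_neighbours:
  assumes "graph G" "v \<in> verts G" "induced_free (star t) G" "1 \<le> t"
  shows "independence_at_most (\<lambda>u w. u \<rightarrow>\<^bsub>G\<^esub> w) (t - 1) {u \<in> verts G. v \<rightarrow>\<^bsub>G\<^esub> u}"
  unfolding independence_at_most_def
proof (intro allI impI, rule ccontr)
  fix Y assume Y: "Y \<subseteq> {u \<in> verts G. v \<rightarrow>\<^bsub>G\<^esub> u}" "independent (\<lambda>u w. u \<rightarrow>\<^bsub>G\<^esub> w) Y"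
    and "\<not> card Y \<le> t - 1"
  then have "t \<le> card Y" by simp
  then obtain Z where Z: "Z \<subseteq> Y" "card Z = t" by (meson obtain_subset_with_card_n)
  have "independent (\<lambda>u w. u \<rightarrow>\<^bsub>G\<^esub> w) Z"
    using Y(2) Z(1) by (auto simp: independent_def intro: pairwise_subset)
  moreover have "finite Z" using Z(2) assms(4) by (intro card_ge_0_finite) simp
  ultimately have "\<not> induced_free (star (card Z)) G"
    using Y(1) Z(1) by (intro induced_star[OF assms(1,2)]) auto
  then show False using assms(3) Z(2) by simp
qed

lemma chromatic_number_le_of_neighbourhoods:
  assumes "graph G" "induced_free (star t) G" "2 \<le> t"
    and "\<And>v. v \<in> verts G \<Longrightarrow> colourable (\<lambda>u w. u \<rightarrow>\<^bsub>G\<^esub> w) K {u \<in> verts G. v \<rightarrow>\<^bsub>G\<^esub> u}"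
  shows "chromatic_number G \<le> (t - 1) * (K + 1)"
proof -
  interpret graph G by fact
  interpret adjacency "\<lambda>u w. u \<rightarrow>\<^bsub>G\<^esub> w"
    by (rule adjacency_of_graph) fact
  have "colourable (\<lambda>u w. u \<rightarrow>\<^bsub>G\<^esub> w) ((t - 1) * (K + 1)) (verts G)"
    using assms by (intro colourable_of_neighbourhoods independence_neighbours) auto
  moreover have "chromatic_number (G \<restriction> verts G) = chromatic_number G"
  proof -
    have "{e \<in> arcs G. tail G e \<in> verts G \<and> head G e \<in> verts G} = arcs G" by auto
    then have "G \<restriction> verts G = G" unfolding induce_subgraph_def by simp
    then show ?thesis by simp
  qed
  ultimately show ?thesis
    using colourable_iff_chromatic_number[OF assms(1) order_refl] by metis
qed

theorem theorem1p4:
  fixes G :: "('a, 'b) pre_digraph"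
  assumes "graph G"
  shows "(\<forall>t r :: nat. 4 \<le> t \<longrightarrow> induced_free (star t) G \<longrightarrow> path_chromatic_number G \<le> r \<longrightarrow>
            int (chromatic_number G) \<le> (int t - 1) * (int r + int ((t - 1) choose 2) - 3))
       \<and> (induced_free (star 3) G \<longrightarrow> chromatic_number G \<le> 2 * path_chromatic_number G)"
proof -
  interpret graph G by fact
  interpret adjacency "\<lambda>u w. u \<rightarrow>\<^bsub>G\<^esub> w"
    by (rule adjacency_of_graph) fact
  let ?E = "\<lambda>u w. u \<rightarrow>\<^bsub>G\<^esub> w"
  let ?N = "\<lambda>v. {u \<in> verts G. v \<rightarrow>\<^bsub>G\<^esub> u}"
  have fin: "finite (?N v)" for v by simp
  have paths: "paths_colourable ?E (r - 1) (?N v)"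
    if "path_chromatic_number G \<le> r" "v \<in> verts G" for r v
    using paths_colourable_neighbours[OF paths_colourable_path_chromatic_number] that assms by blast
  \<comment> \<open>A single vertex is a path, so \<open>r - 1\<close> is a true predecessor unless \<open>G\<close> is the null graph.\<close>
  have pos: "1 \<le> r" if r: "path_chromatic_number G \<le> r" "verts G \<noteq> {}" for r
  proof -
    obtain v where v: "v \<in> verts G" using r(2) by blast
    have "simple_path ?E [v]" by (simp add: simple_path_def)
    moreover have "set [v] \<subseteq> verts G" using v by simp
    ultimately have "colourable ?E r (set [v])"
      using paths_colourable_path_chromatic_number[OF assms r(1)]
      unfolding paths_colourable_def by blast
    then show ?thesis by (auto simp: colourable_def)
  qed
  have null: "chromatic_number G = 0" if empty: "verts G = {}"
  proof -
    have "\<not> u \<rightarrow>\<^bsub>G\<^esub> v" for u v using adj_in_verts(1) empty by blast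
    then have "proper_colouring G 0 c" for c by (simp add: proper_colouring_def empty)
    then have "\<exists>c. proper_colouring G 0 c" by blast
    then show ?thesis unfolding chromatic_number_def by (rule Least_eq_0)
  qed
  have large: "int (chromatic_number G) \<le> (int t - 1) * (int r + int ((t - 1) choose 2) - 3)"
    if t: "4 \<le> t" "induced_free (star t) G" "path_chromatic_number G \<le> r" for t r
  proof -
    have Suc: "t - 1 = Suc (t - 2)" using t(1) by linarith
    have "0 < t - 2 choose 2" using t(1) by (intro zero_less_binomial) simp
    then have binom: "t - 1 choose 2 = (t - 2) + (t - 2 choose 2)" "1 \<le> t - 2 choose 2"
      using choose_2_Suc[of "t - 2"] unfolding Suc by linarith+
    show ?thesis
    proof (cases "verts G = {}")
      case True
      have "3 \<le> t - 1 choose 2" using binom t(1) by linarith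
      then show ?thesis using null[OF True] t(1) by simp
    next
      case False
      let ?b = "t - 1 choose 2"
      let ?K = "(r - 1) + ((t - 2 choose 2) - 1)"
      have "chromatic_number G \<le> (t - 1) * (?K + 1)"
      proof (rule chromatic_number_le_of_neighbourhoods[OF assms t(2)])
        fix v assume v: "v \<in> verts G"
        have "independence_at_most ?E (t - 1) (?N v)"
          using independence_neighbours[OF assms v t(2)] t(1) by simp
        moreover have "3 \<le> t - 1" "t - 1 - 1 = t - 2" using t(1) by simp_all
        ultimately show "colourable ?E ?K (?N v)"
          using colourable_independence[OF _ fin paths[OF t(3) v], of "t - 1"] by metis
      qed (use t(1) in simp)
      also have "\<dots> \<le> (t - 1) * (r + ?b - 3)"
      proof (rule mult_le_mono2)
        show "?K + 1 \<le> r + ?b - 3" using binom pos[OF t(3) False] t(1) by linarith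
      qed
      finally have "int (chromatic_number G) \<le> int (t - 1) * int (r + ?b - 3)"
        unfolding of_nat_mult[symmetric] by (rule of_nat_mono)
      moreover have "int (t - 1) = int t - 1" using t(1) by linarith
      moreover have "int (r + ?b - 3) = int r + int ?b - 3" using binom t(1) by linarith
      ultimately show ?thesis by simp
    qed
  qed
  have claw: "chromatic_number G \<le> 2 * path_chromatic_number G" if "induced_free (star 3) G"
  proof (cases "verts G = {}")
    case True
    then show ?thesis using null by simp
  next
    case False
    let ?r = "path_chromatic_number G"
    have "chromatic_number G \<le> (3 - 1) * ((?r - 1) + 1)"
    proof (rule chromatic_number_le_of_neighbourhoods[OF assms that])
      fix v assume v: "v \<in> verts G"
      have "independence_at_most ?E 3 (?N v)"
        using independence_neighbours[OF assms v that] by (rule independence_at_most_mono) auto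
      then show "colourable ?E (?r - 1) (?N v)"
        by (rule colourable_independence_3[OF fin paths[OF order_refl v]])
    qed simp
    then show ?thesis using pos[OF order_refl False] by simp
  qed
  show ?thesis using large claw by blast
qed

end
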